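(* Let $0\le m\le n$ be integers. The coefficient function for the mapping from $\{x^m,x^{m+1},\ldots,x^n\}$ to $\{b_m^m(x),b_m^{m+1}(x),\ldots,b_m^n(x)\}$ is $$\alpha(n,m,k)=(-1)^{n-m-k}\,\frac{\binom{n}{k}}{\binom{n}{m}},\qquad 0\le k\le n-m.$$ That is, for every integer $p$ with $m\le p\le n$, $$x^p=\sum_{l=0}^{p-m}(-1)^{p-m-l}\,\frac{\binom{p}{l}}{\binom{p}{m}}\;b_m^{p-l}(x).$$
   Context: For integers $0\le m\le n$ the Bernstein polynomial is $b_m^n(x)=\sum_{l=m}^{n}\binom{n}{l}\binom{l}{m}(-1)^{l-m}x^l=\binom{n}{m}x^m(1-x)^{n-m}$. A coefficient function $\alpha$ for the mapping from the monomials to the basis $\{b_m^m,\ldots,b_m^n\}$ is the function giving the coefficients: $x^p=\sum_{l=0}^{p-m}\alpha(p,m,l)\,b_m^{p-l}(x)$. *)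

theory Defs
  imports "HOL-Analysis.Analysis"
begin

text \<open>The Bernstein polynomial $b_m^n(x)$ is the library function \<open>Bernstein n m x\<close>
  (upper index first); the next lemma gives its expansion in monomials.\<close>

lemma Bernstein_monomial_expansion:
  fixes m n :: nat and x :: real
  assumes "m \<le> n"
  shows "Bernstein n m x
    = (\<Sum>l=m..n. real (n choose l) * real (l choose m) * (-1) ^ (l - m) * x ^ l)"
proof -
  have "(\<Sum>l=m..n. real (n choose l) * real (l choose m) * (-1) ^ (l - m) * x ^ l)
      = (\<Sum>l=m..n. real (n choose m) * real ((n - m) choose (l - m)) * (-1) ^ (l - m) * x ^ l)"
    by (intro sum.cong refl) (simp add: choose_mult flip: of_nat_mult)
  also have "\<dots> = (\<Sum>j\<le>n - m. real (n choose m) * real ((n - m) choose j) * (-1) ^ j * x ^ (j + m))"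
    by (rule sum.reindex_bij_witness[of _ "\<lambda>j. j + m" "\<lambda>l. l - m"]) (use assms in auto)
  also have "\<dots> = real (n choose m) * x ^ m
      * (\<Sum>j\<le>n - m. real ((n - m) choose j) * (- x) ^ j * 1 ^ (n - m - j))"
    unfolding sum_distrib_left
    by (intro sum.cong refl) (simp add: power_add power_minus[of x] mult_ac)
  also have "\<dots> = real (n choose m) * x ^ m * (- x + 1) ^ (n - m)"
    by (subst binomial_ring) simp
  also have "\<dots> = Bernstein n m x"
    by (simp add: Bernstein_def)
  finally show ?thesis ..
qed

text \<open>Only the values \<open>\<alpha> p m l\<close> with \<open>m \<le> p \<le> n\<close> and \<open>l \<le> p - m\<close> matter.\<close>

definition coefficient_function :: "nat \<Rightarrow> nat \<Rightarrow> (nat \<Rightarrow> nat \<Rightarrow> nat \<Rightarrow> real) \<Rightarrow> bool" where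
  "coefficient_function m n \<alpha> \<longleftrightarrow>
    (\<forall>p. m \<le> p \<and> p \<le> n \<longrightarrow>
      (\<forall>x::real. x ^ p = (\<Sum>l=0..p - m. \<alpha> p m l * Bernstein (p - l) m x)))"

end

theory Submission imports Defs begin

text \<open>Up to the common factor \<open>x ^ m\<close>, the polynomials \<open>Bernstein (p - l) m x\<close> with
  \<open>l \<le> p - m\<close> are nonzero multiples of the powers \<open>(1 - x) ^ (p - m - l)\<close>. Expanding
  \<open>x ^ p\<close> in them is therefore the binomial expansion of \<open>x ^ (p - m)\<close> as a power of
  \<open>1 - (1 - x)\<close>, and the trinomial revision in \<open>choose_revision\<close> turns its coefficients
  into the quotients of binomial coefficients (\<open>power_eq_sum_Bernstein\<close>). The powers of
  \<open>1 - x\<close> are linearly independent on the infinite set of nonzero \<open>x\<close>, where the factor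
  \<open>x ^ m\<close> can be cancelled, so no other coefficients are possible
  (\<open>Bernstein_linear_independent\<close>).\<close>

text \<open>Both sides count the pairs of disjoint subsets of sizes \<open>l\<close> and \<open>m\<close> in a set of
  size \<open>p\<close>.\<close>

lemma choose_revision:
  fixes p m l :: nat
  assumes "m \<le> p" "l \<le> p - m"
  shows "(p choose l) * (p - l choose m) = (p choose m) * (p - m choose l)"
proof -
  have "(p choose (p - l)) * (p - l choose m) = (p choose m) * (p - m choose (p - l - m))"
    using assms by (intro choose_mult) auto
  moreover have "p choose (p - l) = p choose l"
    using assms by (intro binomial_symmetric[symmetric]) auto
  moreover have "p - m choose (p - l - m) = p - m choose l"
    using assms binomial_symmetric[of l "p - m"] by (simp add: add.commute)
  ultimately show ?thesis by simp
qed

lemma power_eq_sum_Bernstein: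
  fixes p m :: nat and x :: real
  assumes "m \<le> p"
  shows "x ^ p = (\<Sum>l=0..p - m. (-1) ^ (p - m - l) * (real (p choose l) / real (p choose m))
                 * Bernstein (p - l) m x)"
proof -
  have "(-1) ^ (p - m - l) * (real (p choose l) / real (p choose m)) * Bernstein (p - l) m x
      = x ^ m * (real (p - m choose l) * 1 ^ l * (- (1 - x)) ^ (p - m - l))"
    if "l \<le> p - m" for l
  proof -
    have "real (p choose l) * real (p - l choose m) = real (p choose m) * real (p - m choose l)"
      using choose_revision[OF assms that] by (metis of_nat_mult)
    moreover have "real (p choose m) \<noteq> 0"
      using assms by simp
    ultimately have quotient:
      "real (p choose l) / real (p choose m) * real (p - l choose m) = real (p - m choose l)"
      by (simp add: field_simps)
    have "(-1) ^ (p - m - l) * (real (p choose l) / real (p choose m)) * Bernstein (p - l) m x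
      = (real (p choose l) / real (p choose m) * real (p - l choose m))
        * x ^ m * ((-1) ^ (p - m - l) * (1 - x) ^ (p - m - l))"
      by (simp add: Bernstein_def add.commute)
    also have "\<dots> = real (p - m choose l) * x ^ m * (- (1 - x)) ^ (p - m - l)"
      unfolding quotient by (simp only: power_minus[of "1 - x"])
    finally show ?thesis by simp
  qed
  then have "(\<Sum>l=0..p - m. (-1) ^ (p - m - l) * (real (p choose l) / real (p choose m))
                 * Bernstein (p - l) m x)
      = x ^ m * (\<Sum>l\<le>p - m. real (p - m choose l) * 1 ^ l * (- (1 - x)) ^ (p - m - l))"
    unfolding sum_distrib_left by (intro sum.cong) auto
  also have "\<dots> = x ^ m * (1 + - (1 - x)) ^ (p - m)"
    by (subst binomial_ring) simp
  also have "\<dots> = x ^ p"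
    using assms by (simp flip: power_add)
  finally show ?thesis ..
qed

text \<open>A nontrivial vanishing combination would be \<open>x ^ m\<close> times a nonzero polynomial in
  \<open>1 - x\<close>, which has only finitely many roots.\<close>

lemma Bernstein_linear_independent:
  fixes p m k :: nat and c :: "nat \<Rightarrow> real"
  assumes "m \<le> p"
    and vanish: "\<And>x. (\<Sum>l=0..p - m. c l * Bernstein (p - l) m x) = 0"
    and "k \<le> p - m"
  shows "c k = 0"
proof (rule ccontr)
  assume "c k \<noteq> 0"
  (* d i is the coefficient of (1 - x) ^ i, which occurs in the term l = p - m - i. *)
  define d where "d i = c (p - m - i) * real (m + i choose m)" for i
  have root: "(\<Sum>i\<le>p - m. d i * y ^ i) = 0" if "y \<noteq> 1" for y :: real
  proof -
    have "(\<Sum>l=0..p - m. c l * Bernstein (p - l) m (1 - y))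
        = (\<Sum>i\<le>p - m. (1 - y) ^ m * (d i * y ^ i))"
      using assms(1)
      by (intro sum.reindex_bij_witness[of _ "\<lambda>i. p - m - i" "\<lambda>l. p - m - l"])
        (auto simp: d_def Bernstein_def add.commute)
    then have "(1 - y) ^ m * (\<Sum>i\<le>p - m. d i * y ^ i) = 0"
      using vanish[of "1 - y"] by (simp add: sum_distrib_left)
    then show ?thesis
      using that by simp
  qed
  have "d (p - m - k) \<noteq> 0"
    using \<open>c k \<noteq> 0\<close> assms(3) by (simp add: d_def del: diff_diff_left)
  then have "finite {y. (\<Sum>i\<le>p - m. d i * y ^ i) = 0}"
    unfolding polyfun_finite_roots using diff_le_self by blast
  then have "finite (UNIV - {1 :: real})"
    by (rule rev_finite_subset) (use root in auto)
  then show False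
    by (simp add: infinite_UNIV_char_0)
qed

theorem theorem4:
  fixes m n :: nat
  assumes "m \<le> n"
  shows "(\<forall>\<alpha>. coefficient_function m n \<alpha> \<longleftrightarrow>
            (\<forall>p k. m \<le> p \<and> p \<le> n \<and> k \<le> p - m \<longrightarrow>
              \<alpha> p m k = (-1) ^ (p - m - k) * (real (p choose k) / real (p choose m))))
       \<and> (\<forall>p. m \<le> p \<and> p \<le> n \<longrightarrow>
            (\<forall>x::real. x ^ p =
              (\<Sum>l=0..p - m. (-1) ^ (p - m - l) * (real (p choose l) / real (p choose m))
                 * Bernstein (p - l) m x)))"
proof (intro conjI allI impI iffI)
  fix \<alpha> :: "nat \<Rightarrow> nat \<Rightarrow> nat \<Rightarrow> real" and p k :: nat
  assume coeff: "coefficient_function m n \<alpha>" and range: "m \<le> p \<and> p \<le> n \<and> k \<le> p - m"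
  let ?a = "\<lambda>l. (-1) ^ (p - m - l) * (real (p choose l) / real (p choose m))"
  have "(\<Sum>l=0..p - m. (\<alpha> p m l - ?a l) * Bernstein (p - l) m x) = 0" for x
  proof -
    have "x ^ p = (\<Sum>l=0..p - m. \<alpha> p m l * Bernstein (p - l) m x)"
      using coeff range unfolding coefficient_function_def by blast
    then show ?thesis
      using power_eq_sum_Bernstein[of m p x] range
      by (simp only: left_diff_distrib sum_subtractf)
  qed
  then have "\<alpha> p m k - ?a k = 0"
    using range Bernstein_linear_independent[of m p "\<lambda>l. \<alpha> p m l - ?a l" k] by blast
  then show "\<alpha> p m k = ?a k" by simp
next
  fix \<alpha> :: "nat \<Rightarrow> nat \<Rightarrow> nat \<Rightarrow> real"
  assume "\<forall>p k. m \<le> p \<and> p \<le> n \<and> k \<le> p - m \<longrightarrow>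
    \<alpha> p m k = (-1) ^ (p - m - k) * (real (p choose k) / real (p choose m))"
  then show "coefficient_function m n \<alpha>"
    unfolding coefficient_function_def
    by (auto simp: power_eq_sum_Bernstein[of m] intro!: sum.cong)
next
  fix p :: nat and x :: real
  assume "m \<le> p \<and> p \<le> n"
  then show "x ^ p = (\<Sum>l=0..p - m. (-1) ^ (p - m - l)
      * (real (p choose l) / real (p choose m)) * Bernstein (p - l) m x)"
    using power_eq_sum_Bernstein by blast
qed

end
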